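(* Let $(s,u)$, with $s=(x,y,\theta,z_1,z_2,z_3)\in W^{1,2}([0,t_f];\mathbb{R}^6)$ and $u\in L^\infty([0,t_f];\mathbb{R})$, be an optimal pair for Problem (P3), and let $\lambda=(\lambda_x,\lambda_y,\lambda_\theta,\lambda_{z_1},\lambda_{z_2},\lambda_{z_3})$ be the associated adjoint variable vector (both defined in the context). If the optimal control is singular on an interval $[t',t'']\subset[0,t_f]$, i.e. $\lambda_\theta(t)=0$ for a.e. $t\in[t',t'']$, then the course on this interval, denoted $\theta_{\rm sing}(t)$, is given by $$\theta_{\rm sing}(t)=\arctan\frac{\lambda_y(t)}{\lambda_x(t)},\qquad t\in[t',t''].$$
   Context: Fix real constants $v>0$ (speed), $a>0$, $t_f>0$ and initial data $x_0,y_0,\theta_0\in\mathbb{R}$. Problem (P3): minimize $\varphi(s(t_f)) := z_3(t_f)^2 - z_1(t_f)\,z_2(t_f)$ over all pairs $(s,u)$ with state $s=(x,y,\theta,z_1,z_2,z_3)\in W^{1,2}([0,t_f];\mathbb{R}^6)$ and control $u\in L^\infty([0,t_f];\mathbb{R})$ satisfying, for a.e. $t\in[0,t_f]$, $$\dot x = v\cos\theta,\quad \dot y = v\sin\theta,\quad \dot\theta = u/v,\quad \dot z_1=\frac{x^2}{(x^2+y^2)^2},\quad \dot z_2=\frac{y^2}{(x^2+y^2)^2},\quad \dot z_3=\frac{xy}{(x^2+y^2)^2},$$ $$x(0)=x_0,\quad y(0)=y_0,\quad \theta(0)=\theta_0,\quad z_1(0)=z_2(0)=z_3(0)=0,\qquad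 -va\le u(t)\le va .$$ A pair is optimal if it is feasible and attains the minimum of $\varphi(s(t_f))$ among all feasible pairs. The function $\theta$ is called the course. Hamiltonian: $$H(s,u,\lambda)=\lambda_x v\cos\theta+\lambda_y v\sin\theta+\lambda_\theta\frac{u}{v}+\lambda_{z_1}\frac{x^2}{(x^2+y^2)^2}+\lambda_{z_2}\frac{y^2}{(x^2+y^2)^2}+\lambda_{z_3}\frac{xy}{(x^2+y^2)^2}.$$ Adjoint variable vector: given $(s,u)$, $\lambda:[0,t_f]\to\mathbb{R}^6$ is the (continuous) solution of $\dot\lambda(t)=-\partial H/\partial s\,(s(t),u(t),\lambda(t))$, $\lambda(t_f)=\partial\varphi/\partial s\,(s(t_f))$. Explicitly, with $\bar z_i:=z_i(t_f)$: $\lambda_{z_1}\equiv-\bar z_2$, $\lambda_{z_2}\equiv-\bar z_1$, $\lambda_{z_3}\equiv 2\bar z_3$, and $$\dot\lambda_x=\frac{-2\bar z_2x^3+6\bar z_3x^2y+2(\bar z_2-2\bar z_1)xy^2-2\bar z_3y^3}{(x^2+y^2)^3},\quad \lambda_x(t_f)=0,$$ $$\dot\lambda_y=\frac{-2\bar z_1y^3+6\bar z_3y^2x+2(\bar z_1-2\bar z_2)yx^2-2\bar z_3x^3}{(x^2+y^2)^3},\quad \lambda_y(t_f)=0,$$ $$\dot\lambda_\theta=v(\lambda_x\sin\theta-\lambda_y\cos\theta),\quad \lambda_\theta(t_f)=0.$$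
   Formalization: The arctan formula is proved modulo π: θ = arctan(λ_y/λ_x) + kπ with one integer k on each subinterval where λ_x has no zero; where λ_x = 0 ≠ λ_y, θ = π/2 + kπ; nothing is claimed where λ_x = λ_y = 0. *)

theory Defs
  imports "HOL-Analysis.Analysis"
begin

definition absolutely_continuous_on :: "real set \<Rightarrow> (real \<Rightarrow> 'a::real_normed_vector) \<Rightarrow> bool" where
  "absolutely_continuous_on I f \<longleftrightarrow>
     (\<forall>\<epsilon>>0. \<exists>\<delta>>0. \<forall>(n::nat) a b.
        (\<forall>i<n. a i \<le> b i \<and> {a i..b i} \<subseteq> I) \<longrightarrow>
        disjoint_family_on (\<lambda>i. {a i<..<b i}) {..<n} \<longrightarrow>
        (\<Sum>i<n. b i - a i) < \<delta> \<longrightarrow>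
        (\<Sum>i<n. norm (f (b i) - f (a i))) < \<epsilon>)"

text \<open>On a compact interval, \<open>W\<^sup>1\<^sup>,\<^sup>2\<close> consists of the absolutely continuous functions whose derivative
  (which exists almost everywhere) is square integrable. The elements are identified with their
  continuous representatives, so that pointwise evaluation is meaningful.\<close>

definition sobolev_W12 :: "real \<Rightarrow> (real \<Rightarrow> 'a::euclidean_space) \<Rightarrow> bool" where
  "sobolev_W12 T f \<longleftrightarrow>
     absolutely_continuous_on {0..T} f \<and>
     (\<exists>g. g \<in> borel_measurable (lebesgue_on {0..T}) \<and>
          (AE t in lebesgue_on {0..T}. (f has_vector_derivative g t) (at t within {0..T})) \<and>
          integrable (lebesgue_on {0..T}) (\<lambda>t. (norm (g t))\<^sup>2))"

definition L_infinity :: "real \<Rightarrow> (real \<Rightarrow> real) \<Rightarrow> bool" where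
  "L_infinity T u \<longleftrightarrow>
     u \<in> borel_measurable (lebesgue_on {0..T}) \<and>
     (\<exists>C. AE t in lebesgue_on {0..T}. \<bar>u t\<bar> \<le> C)"

text \<open>The space \<open>\<real>\<^sup>6\<close> as an iterated product, whose inner product and norm are the Euclidean ones;
  the components of a state are \<open>x, y, \<theta>, z\<^sub>1, z\<^sub>2, z\<^sub>3\<close>.\<close>

type_synonym R6 = "real \<times> real \<times> real \<times> real \<times> real \<times> real"

text \<open>At \<open>x = y = 0\<close> the last three components below are \<open>0\<close>, as division by zero yields zero.
  This is harmless: a trajectory reaching the origin would need \<open>z\<^sub>1 + z\<^sub>2\<close> to have
  derivative \<open>1 / (x\<^sup>2 + y\<^sup>2)\<close>, which is not integrable along a curve of constant speed.\<close>

fun dynamics :: "real \<Rightarrow> R6 \<Rightarrow> real \<Rightarrow> R6" where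
  "dynamics v (x, y, \<theta>, z1, z2, z3) u =
     (v * cos \<theta>, v * sin \<theta>, u / v,
      x\<^sup>2 / (x\<^sup>2 + y\<^sup>2)\<^sup>2, y\<^sup>2 / (x\<^sup>2 + y\<^sup>2)\<^sup>2, x * y / (x\<^sup>2 + y\<^sup>2)\<^sup>2)"

fun terminal_cost :: "R6 \<Rightarrow> real" where
  "terminal_cost (x, y, \<theta>, z1, z2, z3) = z3\<^sup>2 - z1 * z2"

definition feasible ::
  "real \<Rightarrow> real \<Rightarrow> real \<Rightarrow> real \<Rightarrow> real \<Rightarrow> real \<Rightarrow> (real \<Rightarrow> R6) \<Rightarrow> (real \<Rightarrow> real) \<Rightarrow> bool" where
  "feasible v a tf x0 y0 \<theta>0 s u \<longleftrightarrow>
     sobolev_W12 tf s \<and> L_infinity tf u \<and>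
     (AE t in lebesgue_on {0..tf}.
        (s has_vector_derivative dynamics v (s t) (u t)) (at t within {0..tf})) \<and>
     s 0 = (x0, y0, \<theta>0, 0, 0, 0) \<and>
     (AE t in lebesgue_on {0..tf}. - v * a \<le> u t \<and> u t \<le> v * a)"

definition optimal ::
  "real \<Rightarrow> real \<Rightarrow> real \<Rightarrow> real \<Rightarrow> real \<Rightarrow> real \<Rightarrow> (real \<Rightarrow> R6) \<Rightarrow> (real \<Rightarrow> real) \<Rightarrow> bool" where
  "optimal v a tf x0 y0 \<theta>0 s u \<longleftrightarrow>
     feasible v a tf x0 y0 \<theta>0 s u \<and>
     (\<forall>s' u'. feasible v a tf x0 y0 \<theta>0 s' u' \<longrightarrow> terminal_cost (s tf) \<le> terminal_cost (s' tf))"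

fun hamiltonian :: "real \<Rightarrow> R6 \<Rightarrow> real \<Rightarrow> R6 \<Rightarrow> real" where
  "hamiltonian v (x, y, \<theta>, z1, z2, z3) u (lx, ly, l\<theta>, lz1, lz2, lz3) =
     lx * v * cos \<theta> + ly * v * sin \<theta> + l\<theta> * (u / v)
     + lz1 * (x\<^sup>2 / (x\<^sup>2 + y\<^sup>2)\<^sup>2) + lz2 * (y\<^sup>2 / (x\<^sup>2 + y\<^sup>2)\<^sup>2) + lz3 * (x * y / (x\<^sup>2 + y\<^sup>2)\<^sup>2)"

text \<open>The gradient of the Hamiltonian with respect to the state does not involve the control, so the
  right-hand side of the adjoint equation is continuous along a feasible trajectory and the equation
  holds at every time (one-sidedly at the end points).\<close>

definition adjoint_vector ::
  "real \<Rightarrow> real \<Rightarrow> (real \<Rightarrow> R6) \<Rightarrow> (real \<Rightarrow> real) \<Rightarrow> (real \<Rightarrow> R6) \<Rightarrow> bool" where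
  "adjoint_vector v tf s u l \<longleftrightarrow>
     (\<forall>t\<in>{0..tf}. \<exists>g. GDERIV (\<lambda>\<sigma>. hamiltonian v \<sigma> (u t) (l t)) (s t) :> g \<and>
                       (l has_vector_derivative - g) (at t within {0..tf})) \<and>
     GDERIV terminal_cost (s tf) :> l tf"

end

theory Submission
  imports Defs
begin

text \<open>The switching function \<open>l\<theta>\<close> is continuous, so vanishing a.e. on the
  singular interval makes it vanish at every point there, and hence so does its derivative. The
  \<theta>-component of the adjoint equation (\<open>adjoint_vector_theta\<close>) says that this
  derivative is \<open>v * (lx * sin \<theta> - ly * cos \<theta>)\<close>; as \<open>v > 0\<close>,
  the vectors \<open>(lx, ly)\<close> and \<open>(cos \<theta>, sin \<theta>)\<close> are parallel.
  Where \<open>lx\<close> is nonzero this gives \<open>tan \<theta> = ly / lx\<close>, that is,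
  \<theta> up to a multiple of pi. The multiple depends continuously on time and is an integer, so
  it cannot change while \<open>lx\<close> stays nonzero.\<close>

lemma absolutely_continuous_on_imp_continuous_on:
  fixes f :: "real \<Rightarrow> 'a::real_normed_vector"
  assumes "absolutely_continuous_on I f" "is_interval I"
  shows "continuous_on I f"
  unfolding continuous_on_iff
proof (intro ballI allI impI)
  fix p e :: real
  assume "p \<in> I" "e > 0"
  then obtain \<delta> where "\<delta> > 0" and \<delta>: "\<And>(n::nat) a b. \<forall>i<n. a i \<le> b i \<and> {a i..b i} \<subseteq> I \<Longrightarrow>
      disjoint_family_on (\<lambda>i. {a i<..<b i}) {..<n} \<Longrightarrow> (\<Sum>i<n. b i - a i) < \<delta> \<Longrightarrow>
      (\<Sum>i<n. norm (f (b i) - f (a i))) < e"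
    using assms(1) unfolding absolutely_continuous_on_def by meson
  \<comment> \<open>A family consisting of one interval turns the condition into uniform
    continuity.\<close>
  have close: "norm (f s - f r) < e" if "r \<in> I" "s \<in> I" "r \<le> s" "s - r < \<delta>" for r s
  proof -
    have "{r..s} \<subseteq> I"
      using assms(2) that unfolding is_interval_1 by (meson atLeastAtMost_iff subsetI)
    then show ?thesis
      using \<delta>[of 1 "\<lambda>_. r" "\<lambda>_. s"] that by (simp add: disjoint_family_on_def)
  qed
  have "dist (f q) (f p) < e" if "q \<in> I" "dist q p < \<delta>" for q
    using close[of p q] close[of q p] that \<open>p \<in> I\<close>
    by (cases "p \<le> q") (auto simp: dist_norm norm_minus_commute)
  with \<open>\<delta> > 0\<close> show "\<exists>d>0. \<forall>q\<in>I. dist q p < d \<longrightarrow> dist (f q) (f p) < e"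
    by blast
qed

text \<open>The zero set is closed, so its complement in the open interval is an open null set,
  hence empty. The end points follow by taking closures, which is where \<open>a < b\<close>
  matters.\<close>

lemma AE_lebesgue_on_Icc_zero_imp_zero:
  fixes f :: "real \<Rightarrow> real"
  assumes "a < b" "continuous_on {a..b} f" "AE t in lebesgue_on {a..b}. f t = 0" "t \<in> {a..b}"
  shows "f t = 0"
proof -
  let ?Z = "{t \<in> {a..b}. f t = 0}"
  have Z: "closed ?Z"
    using continuous_closed_preimage_constant[OF assms(2)] by simp
  have "AE t \<in> {a<..<b} in lebesgue. t \<in> ?Z"
    using assms(3) by (auto simp: AE_restrict_space_iff elim: AE_mp)
  then have "{a<..<b} \<subseteq> ?Z"
    using mem_closed_if_AE_lebesgue_open[OF open_greaterThanLessThan Z] by blast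
  then have "closure {a<..<b} \<subseteq> ?Z"
    using Z by (rule closure_minimal)
  then show ?thesis
    using assms(1,4) by auto
qed

text \<open>Distinct integers are at least 1 apart, so the range is uniformly discrete. This keeps
  the branch of the arctangent fixed along an interval.\<close>

lemma continuous_on_Ints_valued_constant:
  fixes f :: "'a::topological_space \<Rightarrow> real"
  assumes "connected S" "continuous_on S f" "\<And>t. t \<in> S \<Longrightarrow> f t \<in> \<int>"
  shows "f constant_on S"
proof (rule continuous_discrete_range_constant[OF assms(1,2)])
  fix t assume "t \<in> S"
  have "1 \<le> norm (f r - f t)" if "r \<in> S" "f r \<noteq> f t" for r
    using assms(3)[OF \<open>t \<in> S\<close>] assms(3)[OF that(1)] that(2) Ints_nonzero_abs_ge1[of "f r - f t"]
    by simp
  then show "\<exists>e>0. \<forall>r. r \<in> S \<and> f r \<noteq> f t \<longrightarrow> e \<le> norm (f r - f t)"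
    by (intro exI[of _ 1]) auto
qed

text \<open>By the addition formula, \<open>sin (\<theta> - arctan r)\<close> is
  \<open>sin \<theta> - r * cos \<theta>\<close> divided by \<open>sqrt (1 + r\<^sup>2)\<close>, and
  the numerator vanishes.\<close>

lemma tan_eq_imp_arctan_shift:
  assumes "cos \<theta> \<noteq> 0" "tan \<theta> = r"
  obtains k :: int where "\<theta> = arctan r + of_int k * pi"
proof -
  have "sin (\<theta> - arctan r) = 0"
    using assms by (simp add: sin_diff sin_arctan cos_arctan tan_def field_simps)
  then obtain k :: int where "\<theta> - arctan r = of_int k * pi"
    using sin_zero_iff_int2 by blast
  then show thesis
    by (intro that[of k]) simp
qed

text \<open>Only the partial derivative in \<open>\<theta>\<close> of the Hamiltonian is computed, by restricting to a line;
  in this way no case distinction at \<open>x = y = 0\<close> is needed.\<close>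

lemma adjoint_vector_theta:
  assumes "adjoint_vector v tf (\<lambda>t. (x t, y t, \<theta> t, z1 t, z2 t, z3 t)) u
             (\<lambda>t. (lx t, ly t, l\<theta> t, lz1 t, lz2 t, lz3 t))"
    and t: "t \<in> {0..tf}"
  shows "(l\<theta> has_real_derivative v * (lx t * sin (\<theta> t) - ly t * cos (\<theta> t))) (at t within {0..tf})"
proof -
  let ?H = "\<lambda>\<sigma>. hamiltonian v \<sigma> (u t) (lx t, ly t, l\<theta> t, lz1 t, lz2 t, lz3 t)"
  let ?line = "\<lambda>r. (x t, y t, r, z1 t, z2 t, z3 t)"
  obtain g where g: "GDERIV ?H (?line (\<theta> t)) :> g"
    and l: "((\<lambda>t. (lx t, ly t, l\<theta> t, lz1 t, lz2 t, lz3 t)) has_vector_derivative - g)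
              (at t within {0..tf})"
    using assms unfolding adjoint_vector_def by blast
  obtain g1 g2 g3 g4 g5 g6 where g_eq: "g = (g1, g2, g3, g4, g5, g6)"
    by (metis prod.exhaust)
  have "(?line has_derivative (\<lambda>h. (0, 0, h, 0, 0, 0))) (at (\<theta> t))"
    by (intro has_derivative_Pair has_derivative_const has_derivative_ident)
  from has_derivative_compose[OF this g[unfolded gderiv_def]]
  have "((\<lambda>r. ?H (?line r)) has_real_derivative g3) (at (\<theta> t))"
    by (simp add: g_eq has_field_derivative_def mult_commute_abs)
  moreover have "((\<lambda>r. ?H (?line r)) has_real_derivative
      v * (ly t * cos (\<theta> t) - lx t * sin (\<theta> t))) (at (\<theta> t))"
    by (auto intro!: derivative_eq_intros simp: algebra_simps)
  ultimately have "g3 = v * (ly t * cos (\<theta> t) - lx t * sin (\<theta> t))"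
    by (rule DERIV_unique)
  then have "- g3 = v * (lx t * sin (\<theta> t) - ly t * cos (\<theta> t))"
    by (simp add: right_diff_distrib)
  moreover have "(l\<theta> has_real_derivative - g3) (at t within {0..tf})"
    using has_derivative_fst[OF has_derivative_snd[OF has_derivative_snd
        [OF l[unfolded has_vector_derivative_def]]]]
    by (simp add: g_eq has_real_derivative_iff_has_vector_derivative has_vector_derivative_def)
  ultimately show ?thesis
    by simp
qed

lemma adjoint_vector_continuous:
  assumes "adjoint_vector v tf s u l"
  shows "continuous_on {0..tf} l"
  using assms unfolding adjoint_vector_def continuous_on_eq_continuous_within
  by (blast intro: has_vector_derivative_continuous)

text \<open>The course is a continuous real function, while \<open>arctan\<close> only takes values
  between -pi/2 and pi/2, so the formula is read modulo pi, with one multiple per interval free of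
  zeros of \<open>lx\<close>. At a zero of \<open>lx\<close> the quotient would be 0 by convention;
  there the arctangent of an infinite slope, pi/2 modulo pi, takes its place. If \<open>ly\<close>
  vanishes too, the relation between costates and course is 0 = 0.\<close>

theorem proposition2:
  fixes v a tf x0 y0 \<theta>0 t' t'' :: real
    and x y \<theta> z1 z2 z3 u :: "real \<Rightarrow> real"
    and lx ly l\<theta> lz1 lz2 lz3 :: "real \<Rightarrow> real"
  assumes "v > 0" and "a > 0" and "tf > 0"
    and optimal: "optimal v a tf x0 y0 \<theta>0 (\<lambda>t. (x t, y t, \<theta> t, z1 t, z2 t, z3 t)) u"
    and adjoint: "adjoint_vector v tf (\<lambda>t. (x t, y t, \<theta> t, z1 t, z2 t, z3 t)) u
                    (\<lambda>t. (lx t, ly t, l\<theta> t, lz1 t, lz2 t, lz3 t))"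
    and interval: "0 \<le> t'" "t' < t''" "t'' \<le> tf"
    and singular: "AE t in lebesgue_on {t'..t''}. l\<theta> t = 0"
  shows "(\<forall>c d. t' \<le> c \<and> c \<le> d \<and> d \<le> t'' \<and> (\<forall>t\<in>{c..d}. lx t \<noteq> 0) \<longrightarrow>
            (\<exists>k::int. \<forall>t\<in>{c..d}. \<theta> t = arctan (ly t / lx t) + of_int k * pi)) \<and>
         (\<forall>t\<in>{t'..t''}. lx t = 0 \<and> ly t \<noteq> 0 \<longrightarrow>
            (\<exists>k::int. \<theta> t = pi / 2 + of_int k * pi))"
proof -
  let ?J = "{t'..t''}"
  have J: "?J \<subseteq> {0..tf}"
    using interval by auto
  have "continuous_on {0..tf} (\<lambda>t. (lx t, ly t, l\<theta> t, lz1 t, lz2 t, lz3 t))"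
    by (rule adjoint_vector_continuous[OF adjoint])
  then have cl: "continuous_on ?J (\<lambda>t. (lx t, ly t, l\<theta> t, lz1 t, lz2 t, lz3 t))"
    using J by (rule continuous_on_subset)
  have clx: "continuous_on ?J lx"
    using continuous_on_fst[OF cl] by simp
  have cly: "continuous_on ?J ly"
    using continuous_on_fst[OF continuous_on_snd[OF cl]] by simp
  have cl\<theta>: "continuous_on ?J l\<theta>"
    using continuous_on_fst[OF continuous_on_snd[OF continuous_on_snd[OF cl]]] by simp
  have "absolutely_continuous_on {0..tf} (\<lambda>t. (x t, y t, \<theta> t, z1 t, z2 t, z3 t))"
    using optimal by (simp add: optimal_def feasible_def sobolev_W12_def)
  then have "continuous_on {0..tf} (\<lambda>t. (x t, y t, \<theta> t, z1 t, z2 t, z3 t))"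
    by (rule absolutely_continuous_on_imp_continuous_on) simp
  then have cs: "continuous_on ?J (\<lambda>t. (x t, y t, \<theta> t, z1 t, z2 t, z3 t))"
    using J by (rule continuous_on_subset)
  have c\<theta>: "continuous_on ?J \<theta>"
    using continuous_on_fst[OF continuous_on_snd[OF continuous_on_snd[OF cs]]] by simp

  have zero: "l\<theta> t = 0" if "t \<in> ?J" for t
    using AE_lebesgue_on_Icc_zero_imp_zero[OF interval(2) cl\<theta> singular that] .
  have eq: "lx t * sin (\<theta> t) = ly t * cos (\<theta> t)" if t: "t \<in> ?J" for t
  proof -
    have "(l\<theta> has_vector_derivative v * (lx t * sin (\<theta> t) - ly t * cos (\<theta> t))) (at t within ?J)"
      using DERIV_subset[OF adjoint_vector_theta[OF adjoint] J] t J
      by (auto simp: has_real_derivative_iff_has_vector_derivative)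
    moreover have "(l\<theta> has_vector_derivative 0) (at t within ?J)"
      by (rule has_vector_derivative_transform[OF t _ has_vector_derivative_const[of 0]])
        (simp add: zero)
    \<comment> \<open>Derivatives within a nondegenerate closed interval are unique, also at its end
      points, where they are one-sided.\<close>
    ultimately have "v * (lx t * sin (\<theta> t) - ly t * cos (\<theta> t)) = 0"
      using interval(2) t by (intro vector_derivative_unique_within_closed_interval) auto
    then show ?thesis
      using \<open>v > 0\<close> by simp
  qed

  have "\<exists>k::int. \<forall>t\<in>{c..d}. \<theta> t = arctan (ly t / lx t) + of_int k * pi"
    if cd: "t' \<le> c" "c \<le> d" "d \<le> t''" and nz: "\<forall>t\<in>{c..d}. lx t \<noteq> 0" for c d
  proof -
    have sub: "{c..d} \<subseteq> ?J"
      using cd by auto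
    \<comment> \<open>The number of half-turns separating the course from the principal
      branch.\<close>
    define m where "m = (\<lambda>t. (\<theta> t - arctan (ly t / lx t)) / pi)"
    have m_Ints: "m t \<in> \<int>" if t: "t \<in> {c..d}" for t
    proof -
      have e: "lx t * sin (\<theta> t) = ly t * cos (\<theta> t)" and lx: "lx t \<noteq> 0"
        using eq sub t nz by auto
      \<comment> \<open>Otherwise \<open>lx t * sin (\<theta> t) = 0\<close>, so sine and cosine
        would vanish together.\<close>
      have cos: "cos (\<theta> t) \<noteq> 0"
      proof
        assume "cos (\<theta> t) = 0"
        then show False
          using e lx sin_cos_squared_add[of "\<theta> t"] by simp
      qed
      have "tan (\<theta> t) = ly t / lx t"
        using e lx cos by (simp add: tan_def field_simps)
      with cos obtain k :: int where "\<theta> t = arctan (ly t / lx t) + of_int k * pi"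
        by (rule tan_eq_imp_arctan_shift)
      then show ?thesis
        by (simp add: m_def)
    qed
    have "continuous_on {c..d} m"
      unfolding m_def using nz
      by (intro continuous_intros continuous_on_subset[OF c\<theta> sub] continuous_on_subset[OF cly sub]
          continuous_on_subset[OF clx sub]) auto
    then have "m constant_on {c..d}"
      using m_Ints by (intro continuous_on_Ints_valued_constant) auto
    then obtain w where w: "\<And>t. t \<in> {c..d} \<Longrightarrow> m t = w"
      unfolding constant_on_def by blast
    \<comment> \<open>The interval contains \<open>c\<close>, so the constant is an attained
      value.\<close>
    have "w \<in> \<int>"
      using m_Ints[of c] w[of c] cd(2) by simp
    then obtain k :: int where "w = of_int k"
      by (auto elim: Ints_cases)
    then have "\<theta> t = arctan (ly t / lx t) + of_int k * pi" if "t \<in> {c..d}" for t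
      using w[OF that] by (simp add: m_def field_simps)
    then show ?thesis
      by blast
  qed
  moreover have "\<exists>k::int. \<theta> t = pi / 2 + of_int k * pi"
    if t: "t \<in> ?J" and "lx t = 0" "ly t \<noteq> 0" for t
  proof -
    \<comment> \<open>This sine is \<open>- cos (\<theta> t)\<close>, and the relation reduces to
      \<open>0 = ly t * cos (\<theta> t)\<close>.\<close>
    have "sin (\<theta> t - pi / 2) = 0"
      using eq[OF t] that by (simp add: sin_diff)
    then obtain k :: int where "\<theta> t - pi / 2 = of_int k * pi"
      using sin_zero_iff_int2 by blast
    then show ?thesis
      by (intro exI[of _ k]) simp
  qed
  ultimately show ?thesis
    by blast
qed

end
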